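(* Let $p\in(1,\infty)$, $L>0$ and $\lambda\in\mathbb{R}$. If $w\in L^\infty(0,L)$ satisfies $$\int_0^L\Big(p\,w\varphi''+(p-1)|w|^{\frac2{p-1}}w\varphi-\lambda|w|^{\frac{2-p}{p-1}}w\varphi\Big)ds=0$$ for any $\varphi\in C^\infty_{\rm c}(0,L)$, then $w\in C^2([0,L])$ and $w$ also satisfies $$p\,w''(s)+(p-1)|w(s)|^{\frac2{p-1}}w(s)-\lambda|w(s)|^{\frac{2-p}{p-1}}w(s)=0\quad\text{in }[0,L].$$
   Context: The expression $|x|^{\frac{2-p}{p-1}}x=\mathrm{sign}(x)|x|^{\frac1{p-1}}$ is read as $0$ at $x=0$. That $w\in C^2([0,L])$ means $w$ has a representative in this class. *)

theory Defs
  imports "HOL-Analysis.Analysis"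
begin

text \<open>Membership of (the class of) a real function in \<open>L\<^sup>\<infinity>(a,b)\<close>; values outside the
  interval are irrelevant.\<close>

definition Linfty_on :: "real \<Rightarrow> real \<Rightarrow> (real \<Rightarrow> real) set" where
  "Linfty_on a b = {w. w \<in> borel_measurable (lebesgue_on {a<..<b}) \<and>
     (\<exists>C. AE s in lebesgue_on {a<..<b}. \<bar>w s\<bar> \<le> C)}"

text \<open>The test functions \<open>C\<^sub>c\<^sup>\<infinity>(a,b)\<close>, extended by zero to the whole line. The support is closed
  in the line and bounded, hence automatically a compact subset of the open interval.\<close>

definition test_functions :: "real \<Rightarrow> real \<Rightarrow> (real \<Rightarrow> real) set" where
  "test_functions a b = {\<phi>. (\<forall>n. (deriv ^^ n) \<phi> differentiable_on UNIV) \<and>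
     closure {s. \<phi> s \<noteq> 0} \<subseteq> {a<..<b}}"

text \<open>\<open>v \<in> C\<^sup>2([a,b])\<close> with first and second derivatives \<open>v'\<close>, \<open>v''\<close>; derivatives at the
  endpoints are one-sided. Continuity of \<open>v\<close> and \<open>v'\<close> follows from differentiability.\<close>

definition C2_on_Icc_with ::
    "real \<Rightarrow> real \<Rightarrow> (real \<Rightarrow> real) \<Rightarrow> (real \<Rightarrow> real) \<Rightarrow> (real \<Rightarrow> real) \<Rightarrow> bool" where
  "C2_on_Icc_with a b v v' v'' \<longleftrightarrow>
     (\<forall>s\<in>{a..b}. (v has_real_derivative v' s) (at s within {a..b})) \<and>
     (\<forall>s\<in>{a..b}. (v' has_real_derivative v'' s) (at s within {a..b})) \<and>
     continuous_on {a..b} v''"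

end

theory Submission
  imports Defs
begin

text \<open>Write \<open>f(w)\<close> for the zeroth-order terms. Two formal integrations turn the weak equation into
  \<open>\<integral> (p w + H) \<phi>'' = 0\<close> with \<open>H(t) = \<integral> max 0 (t - s) f(w(s)) ds\<close>; by Fubini this needs no regularity of
  \<open>w\<close>. The du Bois-Reymond lemma makes \<open>p w + H\<close> affine almost everywhere, and \<open>H\<close> is Lipschitz, so
  \<open>w\<close> has a continuous representative \<open>v\<close>. Now \<open>H\<close> is a double antiderivative of the continuous
  function \<open>f(v)\<close>, hence \<open>v\<close> is \<open>C\<^sup>2\<close> up to the endpoints.\<close>

subsection \<open>Smooth functions and test functions\<close>

text \<open>The obstacle is the singular term: for \<open>p > 2\<close> the exponent
  \<open>(2 - p) / (p - 1)\<close> is negative, and for \<open>lam \<noteq> 0\<close> the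
  nonlinearity is not Lipschitz at 0. Including the factor \<open>w\<close>, the term still has size
  \<open>\<bar>w\<bar> powr (1 / (p - 1))\<close>, so it is continuous, and continuity is all that
  the argument asks of \<open>f\<close>. The kernel \<open>max 0 (t - s)\<close> is the fundamental
  solution of the second derivative that vanishes for \<open>t \<le> s\<close>. It is used from both
  sides: integrated in \<open>t\<close> against the second derivative of a test function it returns
  the test function at \<open>s\<close>; integrated in \<open>s\<close> against a continuous
  \<open>F\<close> it gives a Taylor remainder of a double antiderivative of \<open>F\<close>. The
  first use handles the weak equation, the second the classical one. The endpoints cost nothing
  extra: the resulting formula for \<open>v\<close> is differentiable on the whole line, although
  the test functions only see the open interval.\<close>

primrec times_differentiable :: "nat \<Rightarrow> (real \<Rightarrow> real) \<Rightarrow> bool" where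
  "times_differentiable 0 f \<longleftrightarrow> f differentiable_on UNIV"
| "times_differentiable (Suc n) f \<longleftrightarrow> f differentiable_on UNIV \<and> times_differentiable n (deriv f)"

definition smooth :: "(real \<Rightarrow> real) \<Rightarrow> bool" where
  "smooth f \<longleftrightarrow> (\<forall>n. (deriv ^^ n) f differentiable_on UNIV)"

text \<open>\<open>deriv ^^ n\<close> adds derivatives on the outside, whereas the recursion of
  \<open>times_differentiable\<close> differentiates first. The latter suits inductions that
  generalise over the function, as the sum, product and chain rules require. Index \<open>n\<close>
  stands for \<open>n + 1\<close> derivatives.\<close>

lemma smooth_iff_times_differentiable: "smooth f \<longleftrightarrow> (\<forall>n. times_differentiable n f)"
proof -
  have "times_differentiable n f \<longleftrightarrow> (\<forall>k\<le>n. (deriv ^^ k) f differentiable_on UNIV)" for n f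
  proof (induction n arbitrary: f)
    case (Suc n)
    have "(\<forall>k\<le>Suc n. (deriv ^^ k) f differentiable_on UNIV) \<longleftrightarrow>
        f differentiable_on UNIV \<and> (\<forall>k\<le>n. (deriv ^^ Suc k) f differentiable_on UNIV)"
      by (metis Suc_le_mono eq_id_iff funpow_0 not0_implies_Suc zero_le)
    then show ?case
      using Suc by (simp add: funpow_Suc_right del: funpow.simps)
  qed simp
  then show ?thesis
    by (auto simp: smooth_def)
qed

lemma differentiable_onI_DERIV:
  fixes f :: "real \<Rightarrow> real"
  assumes "\<And>x. (f has_real_derivative f' x) (at x)"
  shows "f differentiable_on UNIV"
  using assms real_differentiable_def unfolding differentiable_on_def by blast

lemma times_differentiable_imp_DERIV:
  "times_differentiable n f \<Longrightarrow> (f has_real_derivative deriv f x) (at x)"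
  by (cases n) (auto simp: differentiable_on_def DERIV_deriv_iff_real_differentiable)

lemma times_differentiable_SucI:
  assumes "\<And>x. (f has_real_derivative f' x) (at x)" "times_differentiable n f'"
  shows "times_differentiable (Suc n) f"
proof -
  have "deriv f = f'"
    using assms(1) by (intro ext DERIV_imp_deriv)
  then show ?thesis
    using assms differentiable_onI_DERIV by auto
qed

lemma times_differentiable_0I:
  assumes "\<And>x. (f has_real_derivative f' x) (at x)"
  shows "times_differentiable 0 f"
  using assms differentiable_onI_DERIV by auto

text \<open>For the product rule, where an undifferentiated factor survives beside the derivative of
  the other.\<close>

lemma times_differentiable_SucD: "times_differentiable (Suc n) f \<Longrightarrow> times_differentiable n f"
  by (induction n arbitrary: f) auto

lemma times_differentiable_add:
  "times_differentiable n f \<Longrightarrow> times_differentiable n g \<Longrightarrow> times_differentiable n (\<lambda>x. f x + g x)"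
proof (induction n arbitrary: f g)
  case 0
  then show ?case by simp
next
  case (Suc n)
  show ?case
  proof (rule times_differentiable_SucI)
    show "((\<lambda>x. f x + g x) has_real_derivative deriv f x + deriv g x) (at x)" for x
      using Suc.prems[THEN times_differentiable_imp_DERIV] by (auto intro: DERIV_add)
  qed (use Suc in auto)
qed

lemma times_differentiable_mult:
  "times_differentiable n f \<Longrightarrow> times_differentiable n g \<Longrightarrow> times_differentiable n (\<lambda>x. f x * g x)"
proof (induction n arbitrary: f g)
  case 0
  then show ?case by simp
next
  case (Suc n)
  show ?case
  proof (rule times_differentiable_SucI)
    show "((\<lambda>x. f x * g x) has_real_derivative deriv f x * g x + deriv g x * f x) (at x)" for x
      using Suc.prems[THEN times_differentiable_imp_DERIV] by (auto intro: DERIV_mult)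
    show "times_differentiable n (\<lambda>x. deriv f x * g x + deriv g x * f x)"
      using Suc.prems times_differentiable_SucD
      by (intro times_differentiable_add Suc.IH) auto
  qed
qed

lemma times_differentiable_const: "times_differentiable n (\<lambda>x. c)"
proof (induction n arbitrary: c)
  case (Suc n)
  show ?case
    by (rule times_differentiable_SucI[where f'="\<lambda>_. 0"]) (use Suc in auto)
qed simp

lemma times_differentiable_compose_affine:
  "times_differentiable n f \<Longrightarrow> times_differentiable n (\<lambda>x. f (c * x + d))"
proof (induction n arbitrary: f)
  case 0
  have "((\<lambda>x. f (c * x + d)) has_real_derivative deriv f (c * x + d) * c) (at x)" for x
    by (rule DERIV_chain2[OF times_differentiable_imp_DERIV[OF 0]])
       (auto intro!: derivative_eq_intros)
  then show ?case by (rule times_differentiable_0I)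
next
  case (Suc n)
  show ?case
  proof (rule times_differentiable_SucI)
    show "((\<lambda>x. f (c * x + d)) has_real_derivative deriv f (c * x + d) * c) (at x)" for x
      by (rule DERIV_chain2[OF times_differentiable_imp_DERIV[OF Suc.prems]])
         (auto intro!: derivative_eq_intros)
    show "times_differentiable n (\<lambda>x. deriv f (c * x + d) * c)"
      using Suc by (intro times_differentiable_mult times_differentiable_const) auto
  qed
qed

section \<open>The flat exponential and its smoothness\<close>

text \<open>The powers of \<open>x\<close> make the family closed under differentiation up to linear combinations.\<close>

definition flat_exp :: "nat \<Rightarrow> real \<Rightarrow> real" where
  "flat_exp k x = (if 0 < x then exp (- 1 / x) / x ^ k else 0)"

text \<open>Under \<open>y = inverse x\<close> this is the decay of \<open>y ^ k / exp y\<close> at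
  infinity.\<close>

lemma flat_exp_tendsto_0_at_right: "(flat_exp k \<longlongrightarrow> 0) (at_right 0)"
proof -
  have "((\<lambda>y::real. y ^ k / exp y) \<longlongrightarrow> 0) at_top"
    by (rule tendsto_power_div_exp_0)
  then have "((\<lambda>x::real. inverse x ^ k / exp (inverse x)) \<longlongrightarrow> 0) (at_right 0)"
    using filterlim_compose filterlim_inverse_at_top_right by blast
  then show ?thesis
  proof (rule Lim_transform_eventually)
    show "\<forall>\<^sub>F x in at_right 0. inverse x ^ k / exp (inverse x) = flat_exp k x"
      unfolding eventually_at_right_field flat_exp_def
      by (intro exI[of _ 1]) (auto simp: exp_minus field_simps)
  qed
qed

text \<open>Only \<open>x = 0\<close> is delicate. There the difference quotient for
  \<open>h > 0\<close> is \<open>flat_exp k h / h = flat_exp (Suc k) h\<close>, again a member of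
  the family, so its limit is already known; for \<open>h < 0\<close> it is 0.\<close>

lemma DERIV_flat_exp:
  "(flat_exp k has_real_derivative flat_exp (k + 2) x - real k * flat_exp (k + 1) x) (at x)"
proof -
  consider "x < 0" | "x > 0" | "x = 0" by linarith
  then show ?thesis
  proof cases
    case 1
    have "((\<lambda>_. 0) has_real_derivative 0) (at x)" by simp
    moreover have "\<forall>\<^sub>F y in nhds x. 0 = flat_exp k y"
      using eventually_nhds_in_open[of "{..<0}" x] 1
      by (auto elim!: eventually_mono simp: flat_exp_def)
    ultimately show ?thesis
      using 1 by (subst DERIV_cong_ev[OF refl, where g="\<lambda>_. 0"]) (auto simp: flat_exp_def elim: eventually_mono)
  next
    case 2
    have "((\<lambda>x. exp (- 1 / x) / x ^ k) has_real_derivative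
        (exp (- 1 / x) * (1 / (x * x)) * x ^ k - exp (- 1 / x) * (real k * x ^ (k - Suc 0))) / (x ^ k * x ^ k)) (at x)"
      using 2 by (auto intro!: derivative_eq_intros)
    also have "(exp (- 1 / x) * (1 / (x * x)) * x ^ k - exp (- 1 / x) * (real k * x ^ (k - Suc 0))) / (x ^ k * x ^ k)
        = flat_exp (k + 2) x - real k * flat_exp (k + 1) x"
      using 2 by (cases k) (simp_all add: flat_exp_def field_simps)
    finally have "((\<lambda>x. exp (- 1 / x) / x ^ k) has_real_derivative
        flat_exp (k + 2) x - real k * flat_exp (k + 1) x) (at x)" .
    moreover have "\<forall>\<^sub>F y in nhds x. flat_exp k y = exp (- 1 / y) / y ^ k"
      using eventually_nhds_in_open[of "{0<..}" x] 2
      by (auto elim!: eventually_mono simp: flat_exp_def)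
    ultimately show ?thesis
      by (subst DERIV_cong_ev[OF refl]) auto
  next
    case 3
    have "((\<lambda>h. flat_exp k h / h) \<longlongrightarrow> 0) (at_left 0)"
      by (rule Lim_transform_eventually[OF tendsto_const])
         (auto simp: eventually_at_left_field flat_exp_def intro!: exI[of _ "-1"])
    moreover have "((\<lambda>h. flat_exp k h / h) \<longlongrightarrow> 0) (at_right 0)"
      by (rule Lim_transform_eventually[OF flat_exp_tendsto_0_at_right[of "Suc k"]])
         (auto simp: eventually_at_right_field flat_exp_def intro!: exI[of _ "1"])
    ultimately have "((\<lambda>h. flat_exp k h / h) \<longlongrightarrow> 0) (at 0)"
      by (simp add: filterlim_at_split)
    then show ?thesis
      using 3 by (simp add: has_field_derivative_iff flat_exp_def)
  qed
qed

lemma times_differentiable_flat_exp: "times_differentiable n (flat_exp k)"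
proof (induction n arbitrary: k)
  case 0
  show ?case using DERIV_flat_exp by (rule times_differentiable_0I)
next
  case (Suc n)
  have "times_differentiable n (\<lambda>x. flat_exp (k + 2) x + (- real k) * flat_exp (k + 1) x)"
    by (intro times_differentiable_add times_differentiable_mult times_differentiable_const Suc)
  then show ?case
    using DERIV_flat_exp by (intro times_differentiable_SucI) auto
qed

lemma smooth_imp_DERIV: "smooth f \<Longrightarrow> (f has_real_derivative deriv f x) (at x)"
  using smooth_iff_times_differentiable times_differentiable_imp_DERIV by blast

lemma smooth_imp_continuous_on: "smooth f \<Longrightarrow> continuous_on S f"
  by (meson DERIV_isCont continuous_at_imp_continuous_on smooth_imp_DERIV)

lemma smooth_deriv: "smooth f \<Longrightarrow> smooth (deriv f)"
  unfolding smooth_iff_times_differentiable using times_differentiable.simps(2) by blast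

lemma smooth_antiderivative:
  assumes "smooth f" "\<And>x. (F has_real_derivative f x) (at x)"
  shows "smooth F"
  unfolding smooth_iff_times_differentiable
proof
  fix n show "times_differentiable n F"
    using assms by (cases n) (auto simp del: times_differentiable.simps simp: smooth_iff_times_differentiable
      intro: times_differentiable_0I times_differentiable_SucI)
qed

lemma smooth_add: "smooth f \<Longrightarrow> smooth g \<Longrightarrow> smooth (\<lambda>x. f x + g x)"
  by (simp add: smooth_iff_times_differentiable times_differentiable_add)

lemma smooth_mult: "smooth f \<Longrightarrow> smooth g \<Longrightarrow> smooth (\<lambda>x. f x * g x)"
  by (simp add: smooth_iff_times_differentiable times_differentiable_mult)

lemma smooth_const: "smooth (\<lambda>x. c)"
  by (simp add: smooth_iff_times_differentiable times_differentiable_const)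

section \<open>Support criteria for test functions\<close>

lemma test_functionsI:
  assumes "smooth \<phi>" "a < c" "d < b" "\<And>s. s \<notin> {c..d} \<Longrightarrow> \<phi> s = 0"
  shows "\<phi> \<in> test_functions a b"
proof -
  have "closure {s. \<phi> s \<noteq> 0} \<subseteq> {c..d}"
    using assms(4) by (intro closure_minimal subsetI) (blast, simp)
  also have "\<dots> \<subseteq> {a<..<b}"
    using assms by auto
  finally show ?thesis
    using assms by (simp add: test_functions_def smooth_def)
qed

text \<open>A compact support inside the open interval has a least and a greatest point, and density
  leaves room between these and \<open>a\<close>, \<open>b\<close>. An empty support has no such
  points and is treated apart. The margin later keeps antiderivatives compactly supported.\<close>

lemma test_functionsE:
  assumes "\<phi> \<in> test_functions a b" "a < b"
  obtains c d where "a < c" "c < d" "d < b" "\<And>s. s \<notin> {c<..<d} \<Longrightarrow> \<phi> s = 0"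
proof -
  let ?K = "closure {s. \<phi> s \<noteq> 0}"
  have K: "?K \<subseteq> {a<..<b}"
    using assms by (auto simp: test_functions_def)
  then have "bounded ?K"
    using bounded_closed_interval[of a b] by (elim bounded_subset) auto
  then have cpt: "compact ?K"
    by (simp add: compact_eq_bounded_closed)
  show thesis
  proof (cases "?K = {}")
    case True
    then have z: "\<phi> s = 0" for s
      using closure_subset[of "{s. \<phi> s \<noteq> 0}"] by auto
    obtain c where c: "a < c" "c < b" using dense assms by blast
    obtain d where "c < d" "d < b" using dense c by blast
    with z c show ?thesis using that by blast
  next
    case False
    obtain m where m: "m \<in> ?K" "\<And>y. y \<in> ?K \<Longrightarrow> m \<le> y"
      using compact_attains_inf[OF cpt False] by blast
    obtain n where n: "n \<in> ?K" "\<And>y. y \<in> ?K \<Longrightarrow> y \<le> n"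
      using compact_attains_sup[OF cpt False] by blast
    have "a < m" "n < b" "m \<le> n" using K m n by auto
    obtain c where c: "a < c" "c < m" using dense \<open>a < m\<close> by blast
    obtain d where d: "n < d" "d < b" using dense \<open>n < b\<close> by blast
    have "\<phi> s = 0" if "s \<notin> {c<..<d}" for s
    proof (rule ccontr)
      assume "\<phi> s \<noteq> 0"
      then have "s \<in> ?K" using closure_subset[of "{s. \<phi> s \<noteq> 0}"] by auto
      then show False using m(2)[of s] n(2)[of s] that c d by auto
    qed
    then show ?thesis using c d \<open>m \<le> n\<close> by (intro that[of c d]) auto
  qed
qed

lemma test_functions_imp_smooth: "\<phi> \<in> test_functions a b \<Longrightarrow> smooth \<phi>"
  by (simp add: test_functions_def smooth_def)

section \<open>Bumps approximating indicators of open intervals\<close>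

lemma flat_exp_0_bounds: "0 \<le> flat_exp 0 x" "flat_exp 0 x \<le> 1"
  by (auto simp: flat_exp_def)

lemma flat_exp_0_tendsto_1: "(flat_exp 0 \<longlongrightarrow> 1) at_top"
proof -
  have "((\<lambda>x::real. - 1 / x) \<longlongrightarrow> 0) at_top"
    by (rule tendsto_divide_0[OF tendsto_const filterlim_at_top_imp_at_infinity[OF filterlim_ident]])
  then have "((\<lambda>x::real. exp (- 1 / x)) \<longlongrightarrow> exp 0) at_top"
    by (rule tendsto_exp)
  moreover have "\<forall>\<^sub>F x in at_top. exp (- 1 / x) = flat_exp 0 x"
    using eventually_gt_at_top[of 0] by eventually_elim (simp add: flat_exp_def)
  ultimately show ?thesis
    by (simp add: Lim_transform_eventually)
qed

text \<open>The shift by \<open>1\<close> keeps the support inside the open interval while the dilation makes the bumps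
  converge to its indicator.\<close>

definition bump :: "real \<Rightarrow> real \<Rightarrow> nat \<Rightarrow> real \<Rightarrow> real" where
  "bump a b n x = flat_exp 0 (real (Suc n) * (x - a) - 1) * flat_exp 0 (real (Suc n) * (b - x) - 1)"

lemma smooth_bump: "smooth (bump a b n)"
proof -
  have "smooth (\<lambda>x. flat_exp 0 (c * x + d))" for c d
    by (simp add: smooth_iff_times_differentiable times_differentiable_compose_affine
        times_differentiable_flat_exp)
  then have "smooth (\<lambda>x. flat_exp 0 (real (Suc n) * x + (- real (Suc n) * a - 1)) *
      flat_exp 0 ((- real (Suc n)) * x + (real (Suc n) * b - 1)))"
    by (intro smooth_mult)
  moreover have "(\<lambda>x. flat_exp 0 (real (Suc n) * x + (- real (Suc n) * a - 1)) *
      flat_exp 0 ((- real (Suc n)) * x + (real (Suc n) * b - 1))) = bump a b n"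
    unfolding bump_def by (simp add: algebra_simps)
  ultimately show ?thesis by simp
qed

lemma bump_bounds: "0 \<le> bump a b n x" "bump a b n x \<le> 1"
  unfolding bump_def by (rule mult_nonneg_nonneg mult_le_one flat_exp_0_bounds)+

text \<open>The bump vanishes outside \<open>{c + 1 / Suc n..d - 1 / Suc n}\<close>. For
  \<open>d \<le> c\<close> it is identically zero, a degenerate case on which later proofs
  rely.\<close>

lemma bump_in_test_functions:
  assumes "a \<le> c" "d \<le> b"
  shows "bump c d n \<in> test_functions a b"
proof (rule test_functionsI[OF smooth_bump])
  have pos: "0 < 1 / real (Suc n)" by simp
  show "a < c + 1 / real (Suc n)" "d - 1 / real (Suc n) < b"
    using assms pos by linarith+
  fix s assume "s \<notin> {c + 1 / real (Suc n)..d - 1 / real (Suc n)}"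
  then have "s - c \<le> 1 / real (Suc n) \<or> d - s \<le> 1 / real (Suc n)"
    unfolding atLeastAtMost_iff by linarith
  then have "real (Suc n) * (s - c) - 1 \<le> 0 \<or> real (Suc n) * (d - s) - 1 \<le> 0"
    by (simp add: pos_le_divide_eq mult.commute del: of_nat_Suc)
  then show "bump c d n s = 0"
    unfolding bump_def flat_exp_def by (elim disjE) simp_all
qed

text \<open>Inside the interval both arguments of \<open>flat_exp 0\<close> grow to infinity, where
  its limit is 1. Outside, one of them is at most \<open>-1\<close> for every
  \<open>n\<close>.\<close>

lemma bump_tendsto: "(\<lambda>n. bump a b n x) \<longlonglongrightarrow> indicator {a<..<b} x"
proof (cases "x \<in> {a<..<b}")
  case True
  have *: "(\<lambda>n. flat_exp 0 (real (Suc n) * y - 1)) \<longlonglongrightarrow> 1" if "y > 0" for y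
  proof (rule filterlim_compose[OF flat_exp_0_tendsto_1])
    have "filterlim (\<lambda>n. y * real (Suc n)) at_top sequentially"
      by (rule filterlim_tendsto_pos_mult_at_top[OF tendsto_const that
            filterlim_compose[OF filterlim_real_sequentially filterlim_Suc]])
    then show "filterlim (\<lambda>n. real (Suc n) * y - 1) at_top sequentially"
      using filterlim_tendsto_add_at_top[OF tendsto_const[of "-1::real"]]
      by (simp add: mult.commute del: of_nat_Suc)
  qed
  show ?thesis
    using True tendsto_mult[OF *[of "x - a"] *[of "b - x"]] by (simp add: bump_def)
next
  case False
  then have "bump a b n x = 0" for n
  proof -
    have "real (Suc n) * (x - a) \<le> 0 \<or> real (Suc n) * (b - x) \<le> 0"
      using False mult_nonneg_nonpos[of "real (Suc n)" "x - a"] mult_nonneg_nonpos[of "real (Suc n)" "b - x"]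
      by (auto simp del: of_nat_Suc)
    then show ?thesis
      unfolding bump_def flat_exp_def by (elim disjE) simp_all
  qed
  then show ?thesis
    using False by simp
qed

subsection \<open>The fundamental lemma of the calculus of variations\<close>

text \<open>Continuity up to the endpoints makes \<open>\<psi>\<close> bounded on the compact
  \<open>{a..b}\<close>, so a multiple of \<open>h\<close> dominates the product.\<close>

lemma integrable_mult_continuous:
  fixes h \<psi> :: "real \<Rightarrow> real"
  assumes h: "integrable (lebesgue_on {a<..<b}) h" and \<psi>: "continuous_on UNIV \<psi>"
  shows "integrable (lebesgue_on {a<..<b}) (\<lambda>s. h s * \<psi> s)"
proof -
  have "bounded (\<psi> ` {a..b})"
    by (intro compact_imp_bounded compact_continuous_image continuous_on_subset[OF \<psi>]) auto
  then obtain C where "\<forall>y\<in>\<psi> ` {a..b}. norm y \<le> C"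
    unfolding bounded_iff ..
  then have C: "\<bar>\<psi> s\<bar> \<le> C" if "s \<in> {a..b}" for s
    using that by simp
  have [measurable]: "\<psi> \<in> borel_measurable (lebesgue_on {a<..<b})"
    by (intro continuous_imp_measurable_on_sets_lebesgue continuous_on_subset[OF \<psi>]) auto
  show ?thesis
  proof (rule Bochner_Integration.integrable_bound)
    show "integrable (lebesgue_on {a<..<b}) (\<lambda>s. C * h s)"
      using h by simp
    show "(\<lambda>s. h s * \<psi> s) \<in> borel_measurable (lebesgue_on {a<..<b})"
      using h by measurable
    have "norm (h s * \<psi> s) \<le> norm (C * h s)" if "s \<in> {a<..<b}" for s
      using C[of s] that by (auto simp: abs_mult mult.commute[of "\<bar>h s\<bar>"] intro!: mult_right_mono)
    then show "AE s in lebesgue_on {a<..<b}. norm (h s * \<psi> s) \<le> norm (C * h s)"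
      by (intro AE_I2) simp
  qed
qed

lemma finite_measure_lebesgue_on_Ioo: "finite_measure (lebesgue_on {a<..<b::real})"
  by (rule finite_measure_lebesgue_on) simp

lemma integrable_continuous:
  fixes \<psi> :: "real \<Rightarrow> real"
  assumes "continuous_on UNIV \<psi>"
  shows "integrable (lebesgue_on {a<..<b}) \<psi>"
proof -
  interpret finite_measure "lebesgue_on {a<..<b}" by (rule finite_measure_lebesgue_on_Ioo)
  show ?thesis
    using integrable_mult_continuous[OF integrable_const[of 1] assms] by simp
qed

text \<open>The exceptional set \<open>S\<close> accommodates the kink of the kernel
  \<open>max 0 (t - s)\<close> at \<open>s = t\<close>.\<close>

lemma integral_lebesgue_on_FTC_finite:
  fixes F :: "real \<Rightarrow> real"
  assumes "a \<le> b" "finite S" and contF: "continuous_on {a..b} F"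
    and F: "\<And>x. x \<notin> S \<Longrightarrow> (F has_real_derivative f x) (at x)" and f: "continuous_on UNIV f"
  shows "integral\<^sup>L (lebesgue_on {a<..<b}) f = F b - F a"
proof -
  have "(f has_integral (F b - F a)) {a..b}"
    by (rule fundamental_theorem_of_calculus_interior_strong[OF assms(2,1) _ contF])
      (simp add: has_real_derivative_iff_has_vector_derivative[symmetric] F)
  then have "integral {a..b} f = F b - F a"
    by (rule integral_unique)
  moreover have "integral\<^sup>L (lebesgue_on {a<..<b}) f = integral {a<..<b} f"
    by (rule lebesgue_integral_eq_integral[OF integrable_continuous[OF f]]) simp
  ultimately show ?thesis
    by (simp add: integral_open_interval_real)
qed

lemma integral_lebesgue_on_FTC:
  fixes F :: "real \<Rightarrow> real"
  assumes "a \<le> b" and F: "\<And>x. (F has_real_derivative f x) (at x)" and "continuous_on UNIV f"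
  shows "integral\<^sup>L (lebesgue_on {a<..<b}) f = F b - F a"
  using integral_lebesgue_on_FTC_finite[OF assms(1) finite.emptyI _ F assms(3)]
    DERIV_continuous_on[OF has_field_derivative_at_within[OF F]] by blast

text \<open>Dominated convergence with majorant \<open>\<bar>h s\<bar>\<close>, as the bumps take
  values between 0 and 1.\<close>

lemma bump_tendsto_integral:
  fixes h :: "real \<Rightarrow> real"
  assumes h: "integrable (lebesgue_on {a<..<b}) h" 
  shows "(\<lambda>n. \<integral>s. h s * bump c d n s \<partial>lebesgue_on {a<..<b}) \<longlonglongrightarrow> (\<integral>s. h s * indicator {c<..<d} s \<partial>lebesgue_on {a<..<b})"
proof -
  let ?M = "lebesgue_on {a<..<b}"
  have I: "integrable ?M (\<lambda>s. h s * bump c d n s)" for n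
    by (rule integrable_mult_continuous[OF h smooth_imp_continuous_on[OF smooth_bump]])
  have lim: "(\<lambda>n. h s * bump c d n s) \<longlonglongrightarrow> h s * indicator {c<..<d} s" for s
    by (rule tendsto_mult[OF tendsto_const bump_tendsto])
  have m: "(\<lambda>s. h s * indicator {c<..<d} s) \<in> borel_measurable ?M"
    by (rule borel_measurable_LIMSEQ_real[OF lim borel_measurable_integrable[OF I]])
  have b: "norm (h s * bump c d n s) \<le> \<bar>h s\<bar>" for n s
    using bump_bounds[of c d n s] by (simp add: abs_mult mult_left_le)
  show ?thesis
    by (rule integral_dominated_convergence[OF m borel_measurable_integrable[OF I] integrable_abs[OF h]]) (simp_all add: lim b del: real_norm_def)
qed

text \<open>It suffices that \<open>h\<close> has zero integral over every measurable set. Bumps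
  give this for open intervals, a Dynkin argument for Borel sets, and completeness of the measure
  for Lebesgue sets.\<close>

lemma fundamental_lemma_calculus_of_variations:
  fixes h :: "real \<Rightarrow> real"
  assumes h: "integrable (lebesgue_on {a<..<b}) h"
    and zero: "\<And>\<psi>. \<psi> \<in> test_functions a b \<Longrightarrow> (\<integral>s. h s * \<psi> s \<partial>lebesgue_on {a<..<b}) = 0"
  shows "AE s in lebesgue_on {a<..<b}. h s = 0"
proof (rule sigma_finite_measure.density_zero[OF _ h])
  show "sigma_finite_measure (lebesgue_on {a<..<b})"
    by (rule finite_measure.axioms[OF finite_measure_lebesgue_on_Ioo])
  let ?M = "lebesgue_on {a<..<b}"
  have borel_M: "A \<inter> {a<..<b} \<in> sets ?M" if "A \<in> sets borel" for A
    using that by (auto simp: sets_restrict_space)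
  have si: "set_integrable ?M (A \<inter> {a<..<b}) h" if "A \<in> sets borel" for A
    unfolding set_integrable_def by (intro integrable_mult_indicator h borel_M that)
  have Ioo: "set_lebesgue_integral ?M ({c<..<d} \<inter> {a<..<b}) h = 0" for c d
  proof -
    \<comment> \<open>Clipping to \<open>a\<close> and \<open>b\<close> keeps the bumps admissible.
      The clipped interval may be empty; the bumps are then zero.\<close>
    let ?c = "max a c" and ?d = "min b d"
    have eq: "{c<..<d} \<inter> {a<..<b} = {?c<..<?d}" by auto
    have "(\<lambda>n. \<integral>s. h s * bump ?c ?d n s \<partial>?M) \<longlonglongrightarrow> (\<integral>s. h s * indicator {?c<..<?d} s \<partial>?M)"
      by (rule bump_tendsto_integral[OF h])
    moreover have "(\<integral>s. h s * bump ?c ?d n s \<partial>?M) = 0" for n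
      by (rule zero[OF bump_in_test_functions]) auto
    ultimately have "(\<integral>s. h s * indicator {?c<..<?d} s \<partial>?M) = 0"
      by (simp only: LIMSEQ_const_iff)
    then show ?thesis
      unfolding set_lebesgue_integral_def eq by (simp add: mult.commute)
  qed
  have total: "set_lebesgue_integral ?M (UNIV \<inter> {a<..<b}) h = 0"
    using Ioo[of a b] by simp
  \<comment> \<open>Open intervals, including empty ones, form an intersection-stable generator of
    the Borel sets. The zero integral over the whole interval (\<open>total\<close>) handles
    complements.\<close>
  have borel: "set_lebesgue_integral ?M (A \<inter> {a<..<b}) h = 0" if "A \<in> sets borel" for A
  proof -
    let ?G = "range (\<lambda>(c, d). box c d :: real set)"
    have sets_borel: "sets borel = sigma_sets UNIV ?G"
      unfolding borel_eq_box by (rule sets_measure_of) simp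
    have "Int_stable ?G"
    proof (rule Int_stableI_image)
      fix i j :: "real \<times> real"
      show "\<exists>k\<in>UNIV. (case i of (c, d) \<Rightarrow> box c d) \<inter> (case j of (c, d) \<Rightarrow> box c d) = (case k of (c, d) \<Rightarrow> box c d)"
        by (rule bexI[of _ "(max (fst i) (fst j), min (snd i) (snd j))"])
           (simp_all add: box_real case_prod_unfold)
    qed
    moreover have "?G \<subseteq> Pow UNIV" by simp
    moreover have "A \<in> sigma_sets UNIV ?G"
      using that sets_borel by simp
    ultimately show ?thesis
    proof (induction rule: sigma_sets_induct_disjoint)
      case (compl A)
      then have A: "A \<in> sets borel" by (simp add: sets_borel)
      have "set_lebesgue_integral ?M (A \<inter> {a<..<b} \<union> (UNIV - A) \<inter> {a<..<b}) h =
        set_lebesgue_integral ?M (A \<inter> {a<..<b}) h + set_lebesgue_integral ?M ((UNIV - A) \<inter> {a<..<b}) h"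
        using A by (intro set_integral_Un si) auto
      moreover have "A \<inter> {a<..<b} \<union> (UNIV - A) \<inter> {a<..<b} = UNIV \<inter> {a<..<b}" by auto
      ultimately show ?case using total compl by simp
    next
      case (union A)
      then have A: "A i \<in> sets borel" for i by (auto simp: sets_borel)
      have eq: "(\<Union>i. A i) \<inter> {a<..<b} = (\<Union>i. A i \<inter> {a<..<b})" by auto
      have "set_lebesgue_integral ?M (\<Union>i. A i \<inter> {a<..<b}) h =
          (\<Sum>i. set_lebesgue_integral ?M (A i \<inter> {a<..<b}) h)"
      proof (rule lebesgue_integral_countable_add)
        show "set_integrable ?M (\<Union>i. A i \<inter> {a<..<b}) h"
          unfolding eq[symmetric] using A by (intro si) auto
      qed (use A union borel_M in \<open>auto simp: disjoint_family_on_def\<close>)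
      then show ?case by (simp only: eq union.IH suminf_zero)
    next
      case (basic A)
      then obtain c d where "A = {c<..<d}" by (auto simp: box_real)
      then show ?case by (simp only: Ioo)
    next
      case empty
      show ?case by (simp add: set_lebesgue_integral_def)
    qed
  qed
  \<comment> \<open>A Lebesgue set is a Borel set together with a negligible one, so the two
    integrals agree.\<close>
  fix A assume "A \<in> sets ?M"
  then have A: "A \<in> sets lebesgue" "A \<subseteq> {a<..<b}"
    using sets_restrict_space_iff[of "{a<..<b}" lebesgue A] by simp_all
  then obtain B N where B: "B \<in> sets borel" "negligible N" "B \<union> N = A"
    using sets_lebesgue_almost_borel by metis
  have "N \<in> null_sets lebesgue" "N \<subseteq> {a<..<b}"
    using A(2) B by (auto simp only: negligible_iff_null_sets)
  then have "N \<in> null_sets ?M"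
    using null_sets_restrict_space[of "{a<..<b}" lebesgue N] by simp
  then have "AE s in ?M. s \<notin> N"
    by (rule AE_not_in)
  then have "AE s in ?M. indicator A s *\<^sub>R h s = indicator (B \<inter> {a<..<b}) s *\<^sub>R h s"
  proof (rule eventually_mono)
    fix s assume "s \<notin> N"
    then have "s \<in> A \<longleftrightarrow> s \<in> B \<inter> {a<..<b}" using A(2) B(3) by blast
    then show "indicator A s *\<^sub>R h s = indicator (B \<inter> {a<..<b}) s *\<^sub>R h s"
      by (simp add: indicator_def)
  qed
  then have "set_lebesgue_integral ?M A h = set_lebesgue_integral ?M (B \<inter> {a<..<b}) h"
    unfolding set_lebesgue_integral_def
    by (rule integral_cong_AE[rotated 2])
       (rule borel_measurable_integrable[OF integrable_mult_indicator[OF _ h]],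
         rule \<open>A \<in> sets ?M\<close> borel_M[OF B(1)])+
  then show "set_lebesgue_integral ?M A h = 0"
    using borel B by simp
qed

subsection \<open>The second-order du Bois-Reymond lemma\<close>

lemma test_functions_imp_DERIV:
  "\<phi> \<in> test_functions a b \<Longrightarrow> (\<phi> has_real_derivative deriv \<phi> x) (at x)"
  by (rule smooth_imp_DERIV[OF test_functions_imp_smooth])

lemma test_functions_imp_continuous_on: "\<phi> \<in> test_functions a b \<Longrightarrow> continuous_on S \<phi>"
  by (rule smooth_imp_continuous_on[OF test_functions_imp_smooth])

lemma test_functions_eq_0:
  assumes "\<phi> \<in> test_functions a b" "a < b" "s \<notin> {a<..<b}"
  shows "\<phi> s = 0"
proof -
  obtain c d where "a < c" "c < d" "d < b" "\<And>s. s \<notin> {c<..<d} \<Longrightarrow> \<phi> s = 0"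
    using test_functionsE[OF assms(1,2)] by blast
  moreover from this have "s \<notin> {c<..<d}" using assms(3) by auto
  ultimately show ?thesis by blast
qed

lemma deriv_in_test_functions:
  assumes "\<phi> \<in> test_functions a b" "a < b"
  shows "deriv \<phi> \<in> test_functions a b"
proof -
  obtain c d where cd: "a < c" "c < d" "d < b" and z: "\<And>s. s \<notin> {c<..<d} \<Longrightarrow> \<phi> s = 0"
    using test_functionsE[OF assms] by blast
  show ?thesis
  proof (rule test_functionsI[OF _ cd(1,3)])
    show "smooth (deriv \<phi>)"
      by (rule smooth_deriv[OF test_functions_imp_smooth[OF assms(1)]])
    fix s assume s: "s \<notin> {c..d}"
    have "\<forall>\<^sub>F x in nhds s. x \<in> - {c..d}"
      using s by (intro eventually_nhds_in_open) auto
    then have "\<forall>\<^sub>F x in nhds s. \<phi> x = 0"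
      by (rule eventually_mono) (rule z, auto)
    then have "deriv \<phi> s = deriv (\<lambda>_. 0) s"
      by (rule deriv_cong_ev) simp
    then show "deriv \<phi> s = 0" by simp
  qed
qed

lemma test_functions_add_cmult:
  assumes f: "f \<in> test_functions a b" and g: "g \<in> test_functions a b" and "a < b"
  shows "(\<lambda>x. f x + k * g x) \<in> test_functions a b"
proof -
  obtain c d where cd: "a < c" "d < b" "\<And>s. s \<notin> {c<..<d} \<Longrightarrow> f s = 0"
    using test_functionsE[OF f \<open>a < b\<close>] by blast
  obtain c' d' where cd': "a < c'" "d' < b" "\<And>s. s \<notin> {c'<..<d'} \<Longrightarrow> g s = 0"
    using test_functionsE[OF g \<open>a < b\<close>] by blast
  show ?thesis
  proof (rule test_functionsI)
    show "smooth (\<lambda>x. f x + k * g x)"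
      by (intro smooth_add smooth_mult smooth_const test_functions_imp_smooth[OF f]
          test_functions_imp_smooth[OF g])
    show "a < min c c'" "max d d' < b" using cd cd' by auto
    show "f s + k * g s = 0" if "s \<notin> {min c c'..max d d'}" for s
    proof -
      have "s \<notin> {c<..<d}" "s \<notin> {c'<..<d'}" using that by auto
      then show ?thesis using cd(3) cd'(3) by simp
    qed
  qed
qed

lemma continuous_imp_antiderivative:
  fixes f :: "real \<Rightarrow> real"
  assumes "continuous_on UNIV f"
  obtains F where "\<And>x. (F has_real_derivative f x) (at x)"
proof -
  have "\<exists>F. \<forall>x::real. - \<infinity> < ereal x \<longrightarrow> ereal x < \<infinity> \<longrightarrow> (F has_vector_derivative f x) (at x)"
    using assms by (intro einterval_antiderivative) (simp_all add: continuous_on_eq_continuous_at)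
  then show thesis
    using that by (auto simp: has_real_derivative_iff_has_vector_derivative)
qed

text \<open>Any primitive is constant on either side of the support of \<open>\<psi>\<close>. Zero
  mean says that the two constants coincide, so subtracting \<open>F a\<close> removes both.\<close>

lemma test_functions_antiderivative:
  assumes \<psi>: "\<psi> \<in> test_functions a b" and "a < b"
    and mean0: "integral\<^sup>L (lebesgue_on {a<..<b}) \<psi> = 0"
  obtains \<zeta> where "\<zeta> \<in> test_functions a b" "deriv \<zeta> = \<psi>"
proof -
  obtain c d where cd: "a < c" "c < d" "d < b" and z: "\<And>s. s \<notin> {c<..<d} \<Longrightarrow> \<psi> s = 0"
    using test_functionsE[OF \<psi> \<open>a < b\<close>] by blast
  obtain F where F: "\<And>x. (F has_real_derivative \<psi> x) (at x)"
    using continuous_imp_antiderivative[OF test_functions_imp_continuous_on[OF \<psi>]] by blast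
  have const: "\<exists>k. \<forall>x\<in>S. F x = k" if "convex S" "\<And>x. x \<in> S \<Longrightarrow> \<psi> x = 0" for S
  proof (rule has_field_derivative_zero_constant[OF that(1)])
    show "(F has_real_derivative 0) (at x within S)" if "x \<in> S" for x
      using has_field_derivative_at_within[OF F, of x S] \<open>\<And>x. x \<in> S \<Longrightarrow> \<psi> x = 0\<close>[OF that] by simp
  qed
  have left: "F s = F a" if "s < c" for s
  proof -
    have "\<exists>k. \<forall>x\<in>{..<c}. F x = k" by (rule const[OF convex_real_interval(4)]) (simp add: z)
    then show ?thesis using that cd by force
  qed
  have right: "F s = F b" if "s > d" for s
  proof -
    have "\<exists>k. \<forall>x\<in>{d<..}. F x = k" by (rule const[OF convex_real_interval(3)]) (simp add: z)
    then show ?thesis using that cd by force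
  qed
  have "F b = F a"
    using integral_lebesgue_on_FTC[OF less_imp_le[OF \<open>a < b\<close>] F test_functions_imp_continuous_on[OF \<psi>]]
      mean0 by simp
  have D: "((\<lambda>x. F x - F a) has_real_derivative \<psi> x) (at x)" for x
    using DERIV_diff[OF F DERIV_const] by simp
  show thesis
  proof
    show "(\<lambda>x. F x - F a) \<in> test_functions a b"
    proof (rule test_functionsI[OF _ cd(1,3)])
      show "smooth (\<lambda>x. F x - F a)"
        by (rule smooth_antiderivative[OF test_functions_imp_smooth[OF \<psi>] D])
      show "F s - F a = 0" if "s \<notin> {c..d}" for s
        using that left[of s] right[of s] \<open>F b = F a\<close> by (cases "s < c") auto
    qed
    show "deriv (\<lambda>x. F x - F a) = \<psi>"
      by (rule ext) (rule DERIV_imp_deriv[OF D])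
  qed
qed

text \<open>The derivative of \<open>s * \<zeta> s\<close> has zero integral. This reads off the
  mean of an antiderivative from the first moment of its derivative.\<close>

lemma test_functions_first_moment:
  assumes \<zeta>: "\<zeta> \<in> test_functions a b" and "a < b"
  shows "integral\<^sup>L (lebesgue_on {a<..<b}) \<zeta> = - (\<integral>s. s * deriv \<zeta> s \<partial>lebesgue_on {a<..<b})"
proof -
  note \<zeta>' = deriv_in_test_functions[OF assms]
  note c = test_functions_imp_continuous_on[OF \<zeta>, of UNIV] test_functions_imp_continuous_on[OF \<zeta>', of UNIV]
  have i: "integrable (lebesgue_on {a<..<b}) \<zeta>"
    "integrable (lebesgue_on {a<..<b}) (\<lambda>s. s * deriv \<zeta> s)"
    by (rule integrable_continuous, intro continuous_intros c)+
  have "(\<integral>s. \<zeta> s + s * deriv \<zeta> s \<partial>lebesgue_on {a<..<b}) = b * \<zeta> b - a * \<zeta> a"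
  proof (rule integral_lebesgue_on_FTC)
    show "((\<lambda>s. s * \<zeta> s) has_real_derivative \<zeta> x + x * deriv \<zeta> x) (at x)" for x
      using DERIV_mult[OF DERIV_ident test_functions_imp_DERIV[OF \<zeta>]] by (simp add: mult.commute)
    show "continuous_on UNIV (\<lambda>s. \<zeta> s + s * deriv \<zeta> s)"
      by (intro continuous_intros c)
  qed (use \<open>a < b\<close> in simp)
  then show ?thesis
    using i test_functions_eq_0[OF assms, of a] test_functions_eq_0[OF assms, of b] by simp
qed

text \<open>If every test function had zero mean, the fundamental lemma with \<open>h = 1\<close>
  would give \<open>1 = 0\<close> almost everywhere on an interval of positive length. A test
  function of nonzero mean is then normalised.\<close>

lemma test_functions_unit_mass:
  assumes "a < b"
  obtains \<eta> where "\<eta> \<in> test_functions a b" "integral\<^sup>L (lebesgue_on {a<..<b}) \<eta> = 1"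
proof -
  let ?M = "lebesgue_on {a<..<b}"
  interpret finite_measure ?M by (rule finite_measure_lebesgue_on_Ioo)
  have "\<exists>\<psi>\<in>test_functions a b. integral\<^sup>L ?M \<psi> \<noteq> 0"
  proof (rule ccontr)
    assume "\<not> ?thesis"
    then have "(\<integral>s. 1 * \<psi> s \<partial>?M) = 0" if "\<psi> \<in> test_functions a b" for \<psi>
      using that by simp
    then have "AE s in ?M. (1::real) = 0"
      by (rule fundamental_lemma_calculus_of_variations[OF integrable_const])
    then have "AE s in ?M. False" by simp
    then have "emeasure ?M (space ?M) = 0"
      by (simp only: ae_filter_eq_bot_iff[symmetric] trivial_limit_def)
    moreover have "emeasure ?M (space ?M) = ennreal (b - a)"
      using assms by (simp add: emeasure_restrict_space)
    ultimately show False using assms by simp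
  qed
  then obtain \<psi> where \<psi>: "\<psi> \<in> test_functions a b" "integral\<^sup>L ?M \<psi> \<noteq> 0" by blast
  \<comment> \<open>The bump on an empty interval serves as the zero test function, so that the
    scaling becomes an instance of \<open>test_functions_add_cmult\<close>.\<close>
  have "bump a a 0 \<in> test_functions a b"
    using assms by (intro bump_in_test_functions) auto
  moreover have "bump a a 0 x = 0" for x
    by (simp add: bump_def flat_exp_def)
  ultimately have "(\<lambda>x. 0) \<in> test_functions a b"
    by (metis ext)
  then have "(\<lambda>x. 0 + inverse (integral\<^sup>L ?M \<psi>) * \<psi> x) \<in> test_functions a b"
    by (rule test_functions_add_cmult[OF _ \<psi>(1) assms])
  moreover have "(\<integral>x. 0 + inverse (integral\<^sup>L ?M \<psi>) * \<psi> x \<partial>?M) = 1"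
    using \<psi>(2) by simp
  ultimately show thesis
    by (rule that)
qed

text \<open>Subtracting suitable multiples of \<open>\<eta>\<close> and \<open>deriv \<eta>\<close> from a test function \<open>\<psi>\<close> annihilates its
  moments of order 0 and 1, which makes it the second derivative of a test function.\<close>

lemma du_Bois_Reymond_second_order:
  fixes u :: "real \<Rightarrow> real"
  assumes "a < b" and u: "integrable (lebesgue_on {a<..<b}) u"
    and zero: "\<And>\<phi>. \<phi> \<in> test_functions a b \<Longrightarrow>
      (\<integral>s. u s * deriv (deriv \<phi>) s \<partial>lebesgue_on {a<..<b}) = 0"
  obtains A B where "AE s in lebesgue_on {a<..<b}. u s = A + B * s"
proof -
  let ?M = "lebesgue_on {a<..<b}"
  interpret finite_measure ?M by (rule finite_measure_lebesgue_on_Ioo)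
  obtain \<eta> where \<eta>: "\<eta> \<in> test_functions a b" "integral\<^sup>L ?M \<eta> = 1"
    using test_functions_unit_mass[OF \<open>a < b\<close>] by blast
  note \<eta>' = deriv_in_test_functions[OF \<eta>(1) \<open>a < b\<close>]
  define k \<alpha> \<beta> where "k = (\<integral>s. s * \<eta> s \<partial>?M)" and "\<alpha> = (\<integral>s. u s * \<eta> s \<partial>?M)"
    and "\<beta> = (\<integral>s. u s * deriv \<eta> s \<partial>?M)"
  \<comment> \<open>The coefficients come from testing \<open>u\<close> against
    \<open>\<psi> - m * \<eta> - (m * k - n) * deriv \<eta>\<close>, where \<open>m\<close> and
    \<open>n\<close> are the moments of \<open>\<psi>\<close> of order 0 and 1. Collecting the terms
    in \<open>m\<close> and in \<open>n\<close> under one integral with \<open>\<psi>\<close> leaves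
    the factor \<open>?h\<close>.\<close>
  let ?h = "\<lambda>s. u s - (\<alpha> + \<beta> * k) + \<beta> * s"
  have int: "integrable ?M \<psi>" "integrable ?M (\<lambda>s. s * \<psi> s)" "integrable ?M (\<lambda>s. u s * \<psi> s)"
    if "\<psi> \<in> test_functions a b" for \<psi>
  proof -
    note c = test_functions_imp_continuous_on[OF that, of UNIV]
    show "integrable ?M \<psi>" by (rule integrable_continuous[OF c])
    show "integrable ?M (\<lambda>s. s * \<psi> s)" by (rule integrable_continuous, intro continuous_intros c)
    show "integrable ?M (\<lambda>s. u s * \<psi> s)" by (rule integrable_mult_continuous[OF u c])
  qed
  have "AE s in ?M. ?h s = 0"
  proof (rule fundamental_lemma_calculus_of_variations)
    show "integrable ?M ?h"
      by (intro Bochner_Integration.integrable_add Bochner_Integration.integrable_diff u integrable_const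
          integrable_continuous continuous_intros)
    fix \<psi> assume \<psi>: "\<psi> \<in> test_functions a b"
    define m where "m = integral\<^sup>L ?M \<psi>"
    define n where "n = (\<integral>s. s * \<psi> s \<partial>?M)"
    \<comment> \<open>The mass of \<open>\<psi>\<close> is removed, so that a compactly supported
      antiderivative \<open>\<zeta>\<close> exists.\<close>
    have \<psi>0: "(\<lambda>s. \<psi> s + (- m) * \<eta> s) \<in> test_functions a b"
      by (rule test_functions_add_cmult[OF \<psi> \<eta>(1) \<open>a < b\<close>])
    have "(\<integral>s. \<psi> s + (- m) * \<eta> s \<partial>?M) = 0"
      using int(1)[OF \<psi>] int(1)[OF \<eta>(1)] \<eta>(2) by (simp add: m_def)
    then obtain \<zeta> where \<zeta>: "\<zeta> \<in> test_functions a b" "deriv \<zeta> = (\<lambda>s. \<psi> s + (- m) * \<eta> s)"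
      using test_functions_antiderivative[OF \<psi>0 \<open>a < b\<close>] by blast
    have "(\<integral>s. s * (\<psi> s + (- m) * \<eta> s) \<partial>?M) = (\<integral>s. s * \<psi> s + (- m) * (s * \<eta> s) \<partial>?M)"
      by (simp add: algebra_simps)
    also have "\<dots> = n - m * k"
      using int(2)[OF \<psi>] int(2)[OF \<eta>(1)] by (simp add: n_def k_def)
    finally have d: "integral\<^sup>L ?M \<zeta> = m * k - n"
      using test_functions_first_moment[OF \<zeta>(1) \<open>a < b\<close>] by (simp add: \<zeta>(2))
    \<comment> \<open>\<open>\<zeta>\<close> has mean \<open>m * k - n\<close>; the same correction
      permits a second antiderivative, and differentiating it produces the
      \<open>deriv \<eta>\<close> term.\<close>
    have \<zeta>0: "(\<lambda>s. \<zeta> s + (- (m * k - n)) * \<eta> s) \<in> test_functions a b"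
      by (rule test_functions_add_cmult[OF \<zeta>(1) \<eta>(1) \<open>a < b\<close>])
    have "(\<integral>s. \<zeta> s + (- (m * k - n)) * \<eta> s \<partial>?M) = 0"
      using int(1)[OF \<zeta>(1)] int(1)[OF \<eta>(1)] \<eta>(2) d by simp
    then obtain \<xi> where \<xi>: "\<xi> \<in> test_functions a b" "deriv \<xi> = (\<lambda>s. \<zeta> s + (- (m * k - n)) * \<eta> s)"
      using test_functions_antiderivative[OF \<zeta>0 \<open>a < b\<close>] by blast
    have dd: "deriv (deriv \<xi>) s = \<psi> s - m * \<eta> s - (m * k - n) * deriv \<eta> s" for s
    proof -
      have "(\<zeta> has_real_derivative \<psi> s - m * \<eta> s) (at s)"
        using test_functions_imp_DERIV[OF \<zeta>(1), of s] by (simp add: \<zeta>(2))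
      moreover have "((\<lambda>s. - (m * k - n) * \<eta> s) has_real_derivative - (m * k - n) * deriv \<eta> s) (at s)"
        by (rule DERIV_cmult[OF test_functions_imp_DERIV[OF \<eta>(1)]])
      ultimately have "deriv (deriv \<xi>) s = \<psi> s - m * \<eta> s + - (m * k - n) * deriv \<eta> s"
        unfolding \<xi>(2) by (rule DERIV_imp_deriv[OF DERIV_add])
      then show ?thesis by (simp add: algebra_simps)
    qed
    have "0 = (\<integral>s. u s * \<psi> s - m * (u s * \<eta> s) - (m * k - n) * (u s * deriv \<eta> s) \<partial>?M)"
      using zero[OF \<xi>(1)] by (simp add: dd algebra_simps)
    also have "\<dots> = (\<integral>s. u s * \<psi> s \<partial>?M) - m * \<alpha> - (m * k - n) * \<beta>"
      using int(3)[OF \<psi>] int(3)[OF \<eta>(1)] int(3)[OF \<eta>'] by (simp add: \<alpha>_def \<beta>_def)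
    also have "\<dots> = (\<integral>s. u s * \<psi> s - (\<alpha> + \<beta> * k) * \<psi> s + \<beta> * (s * \<psi> s) \<partial>?M)"
    proof -
      have "(\<integral>s. u s * \<psi> s - (\<alpha> + \<beta> * k) * \<psi> s + \<beta> * (s * \<psi> s) \<partial>?M) =
          (\<integral>s. u s * \<psi> s \<partial>?M) - (\<alpha> + \<beta> * k) * m + \<beta> * n"
        using int[OF \<psi>] by (simp add: m_def n_def)
      then show ?thesis by (simp add: algebra_simps)
    qed
    also have "\<dots> = (\<integral>s. ?h s * \<psi> s \<partial>?M)"
      by (rule Bochner_Integration.integral_cong) (simp_all add: algebra_simps)
    finally show "(\<integral>s. ?h s * \<psi> s \<partial>?M) = 0" ..
  qed
  then have "AE s in ?M. u s = (\<alpha> + \<beta> * k) + (- \<beta>) * s"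
    by eventually_elim (simp add: algebra_simps)
  then show thesis by (rule that)
qed

subsection \<open>Integral representation of weak solutions\<close>

lemma abs_max_diff_le: "\<bar>max 0 (t - s) - max 0 (t' - s)\<bar> \<le> \<bar>t - t'\<bar>" for s t t' :: real
  by (simp add: max_def abs_if)

text \<open>The kernel is 1-Lipschitz in \<open>t\<close> uniformly in \<open>s\<close>, so the
  integral is Lipschitz with constant the L1 norm of \<open>g\<close>.\<close>

lemma continuous_on_integral_kernel:
  fixes g :: "real \<Rightarrow> real"
  assumes g: "integrable (lebesgue_on {a<..<b}) g"
  shows "continuous_on S (\<lambda>t. \<integral>s. g s * max 0 (t - s) \<partial>lebesgue_on {a<..<b})"
proof -
  let ?M = "lebesgue_on {a<..<b}"
  define G where "G = (\<integral>s. \<bar>g s\<bar> \<partial>?M)"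
  have i: "integrable ?M (\<lambda>s. g s * max 0 (t - s))" for t
    by (rule integrable_mult_continuous[OF g]) (intro continuous_intros)
  have "G-lipschitz_on S (\<lambda>t. \<integral>s. g s * max 0 (t - s) \<partial>?M)"
  proof (rule lipschitz_onI)
    fix t t' :: real
    have "\<bar>(\<integral>s. g s * max 0 (t - s) \<partial>?M) - (\<integral>s. g s * max 0 (t' - s) \<partial>?M)\<bar>
        = \<bar>\<integral>s. g s * max 0 (t - s) - g s * max 0 (t' - s) \<partial>?M\<bar>"
      using i by simp
    also have "\<dots> \<le> (\<integral>s. \<bar>g s * max 0 (t - s) - g s * max 0 (t' - s)\<bar> \<partial>?M)"
      by (rule integral_abs_bound)
    also have "\<dots> \<le> (\<integral>s. \<bar>g s\<bar> * \<bar>t - t'\<bar> \<partial>?M)"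
    proof (rule integral_mono)
      show "integrable ?M (\<lambda>s. \<bar>g s * max 0 (t - s) - g s * max 0 (t' - s)\<bar>)"
        by (rule integrable_abs[OF Bochner_Integration.integrable_diff[OF i i]])
      show "integrable ?M (\<lambda>s. \<bar>g s\<bar> * \<bar>t - t'\<bar>)"
        using g by simp
      show "\<bar>g s * max 0 (t - s) - g s * max 0 (t' - s)\<bar> \<le> \<bar>g s\<bar> * \<bar>t - t'\<bar>" for s
        unfolding right_diff_distrib[symmetric] abs_mult
        by (rule mult_left_mono[OF abs_max_diff_le abs_ge_zero])
    qed
    also have "\<dots> = G * \<bar>t - t'\<bar>"
      by (simp add: G_def)
    finally show "dist (\<integral>s. g s * max 0 (t - s) \<partial>?M) (\<integral>s. g s * max 0 (t' - s) \<partial>?M) \<le> G * dist t t'"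
      by (simp add: dist_real_def)
  qed (simp add: G_def)
  then show ?thesis
    by (rule lipschitz_on_continuous_on)
qed

lemma test_functions_kernel_representation:
  assumes \<phi>: "\<phi> \<in> test_functions a b" and s: "s \<in> {a<..<b}"
  shows "(\<integral>t. max 0 (t - s) * deriv (deriv \<phi>) t \<partial>lebesgue_on {a<..<b}) = \<phi> s"
proof -
  have ab: "a < b" using s by simp
  note \<phi>' = deriv_in_test_functions[OF \<phi> ab]
  note \<phi>'' = deriv_in_test_functions[OF \<phi>' ab]
  \<comment> \<open>A primitive of \<open>(r - s) * deriv (deriv \<phi>) r\<close>. Composing it
    with \<open>max t s\<close> freezes it for \<open>t < s\<close>, where the kernel vanishes. The
    boundary terms are \<open>?R b = 0\<close> and \<open>?R s = - \<phi> s\<close>.\<close>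
  let ?R = "\<lambda>r. (r - s) * deriv \<phi> r - \<phi> r"
  have "(?R has_real_derivative (r - s) * deriv (deriv \<phi>) r) (at r)" for r
    using DERIV_diff[OF DERIV_mult[OF DERIV_diff[OF DERIV_ident DERIV_const[of s]]
        test_functions_imp_DERIV[OF \<phi>']] test_functions_imp_DERIV[OF \<phi>], of r]
    by (simp add: mult.commute)
  note R = this
  have "(\<integral>t. max 0 (t - s) * deriv (deriv \<phi>) t \<partial>lebesgue_on {a<..<b}) = ?R (max b s) - ?R (max a s)"
  proof (rule integral_lebesgue_on_FTC_finite[where S="{s}"])
    show "continuous_on {a..b} (\<lambda>t. ?R (max t s))"
      by (rule continuous_on_compose2[of UNIV ?R])
        (intro continuous_intros test_functions_imp_continuous_on[OF \<phi>]
          test_functions_imp_continuous_on[OF \<phi>'] subset_UNIV)+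
    show "continuous_on UNIV (\<lambda>t. max 0 (t - s) * deriv (deriv \<phi>) t)"
      by (intro continuous_intros test_functions_imp_continuous_on[OF \<phi>''])
    fix t assume "t \<notin> {s}"
    then consider "t < s" | "t > s" by fastforce
    then show "((\<lambda>t. ?R (max t s)) has_real_derivative max 0 (t - s) * deriv (deriv \<phi>) t) (at t)"
    proof cases
      case 1
      have "((\<lambda>t. ?R (max t s)) has_real_derivative 0) (at t)"
        by (rule has_field_derivative_transform_within_open[OF DERIV_const[of "?R s"], of "{..<s}"]) (use 1 in simp_all)
      then show ?thesis using 1 by simp
    next
      case 2
      have "((\<lambda>t. ?R (max t s)) has_real_derivative (t - s) * deriv (deriv \<phi>) t) (at t)"
        by (rule has_field_derivative_transform_within_open[OF R, of "{s<..}"]) (use 2 in simp_all)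
      then show ?thesis using 2 by simp
    qed
  qed (use ab in simp_all)
  moreover have "\<phi> b = 0" "deriv \<phi> b = 0"
    using test_functions_eq_0[OF \<phi> ab, of b] test_functions_eq_0[OF \<phi>' ab, of b] by simp_all
  ultimately show ?thesis
    using s by simp
qed

text \<open>Taylor's formula for \<open>F2\<close> at \<open>a\<close> with integral remainder. The
  kernel cuts the integration off at \<open>t\<close>, which \<open>min s t\<close> reproduces in
  the primitive.\<close>

lemma integral_kernel_eq:
  fixes F F1 F2 :: "real \<Rightarrow> real"
  assumes F1: "\<And>x. (F1 has_real_derivative F x) (at x)"
    and F2: "\<And>x. (F2 has_real_derivative F1 x) (at x)"
    and F: "continuous_on UNIV F" and t: "t \<in> {a..b}"
  shows "(\<integral>s. F s * max 0 (t - s) \<partial>lebesgue_on {a<..<b}) = F2 t - F2 a - (t - a) * F1 a"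
proof -
  let ?R = "\<lambda>r. (t - r) * F1 r + F2 r"
  have R: "(?R has_real_derivative F r * (t - r)) (at r)" for r
    using DERIV_add[OF DERIV_mult[OF DERIV_diff[OF DERIV_const[of t] DERIV_ident] F1] F2, of r]
    by simp
  have "(\<integral>s. F s * max 0 (t - s) \<partial>lebesgue_on {a<..<b}) = ?R (min b t) - ?R (min a t)"
  proof (rule integral_lebesgue_on_FTC_finite[where S="{t}"])
    have "continuous_on UNIV ?R"
      by (rule DERIV_continuous_on[OF has_field_derivative_at_within[OF R]])
    then show "continuous_on {a..b} (\<lambda>s. ?R (min s t))"
      by (rule continuous_on_compose2) (intro continuous_intros subset_UNIV)+
    show "continuous_on UNIV (\<lambda>s. F s * max 0 (t - s))"
      by (intro continuous_intros F)
    fix s assume "s \<notin> {t}"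
    then consider "s < t" | "s > t" by fastforce
    then show "((\<lambda>s. ?R (min s t)) has_real_derivative F s * max 0 (t - s)) (at s)"
    proof cases
      case 1
      have "((\<lambda>s. ?R (min s t)) has_real_derivative F s * (t - s)) (at s)"
        by (rule has_field_derivative_transform_within_open[OF R, of "{..<t}"]) (use 1 in simp_all)
      then show ?thesis using 1 by simp
    next
      case 2
      have "((\<lambda>s. ?R (min s t)) has_real_derivative 0) (at s)"
        by (rule has_field_derivative_transform_within_open[OF DERIV_const[of "?R t"], of "{t<..}"]) (use 2 in simp_all)
      then show ?thesis using 2 by simp
    qed
  qed (use t in simp_all)
  then show ?thesis
    using t by (simp add: min_absorb1 min_absorb2)
qed

lemma borel_measurable_imp_bounded_integrable:
  fixes g :: "real \<Rightarrow> real"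
  assumes "g \<in> borel_measurable (lebesgue_on {a<..<b})" "\<And>s. \<bar>g s\<bar> \<le> C"
  shows "integrable (lebesgue_on {a<..<b}) g"
proof -
  interpret finite_measure "lebesgue_on {a<..<b}" by (rule finite_measure_lebesgue_on_Ioo)
  show ?thesis
    using assms(2) by (intro integrable_const_bound[OF AE_I2 assms(1), of C]) simp
qed

text \<open>Fubini replaces two integrations by parts: after the exchange, the inner integral in
  \<open>t\<close> is \<open>\<phi> s\<close> by
  \<open>test_functions_kernel_representation\<close>, and \<open>g\<close> is never
  differentiated.\<close>

lemma integral_test_function_by_parts:
  fixes g :: "real \<Rightarrow> real"
  assumes g: "g \<in> borel_measurable (lebesgue_on {a<..<b})" and bnd: "\<And>s. \<bar>g s\<bar> \<le> C"
    and \<phi>: "\<phi> \<in> test_functions a b" and ab: "a < b"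
  shows "(\<integral>t. (\<integral>s. g s * max 0 (t - s) \<partial>lebesgue_on {a<..<b}) * deriv (deriv \<phi>) t \<partial>lebesgue_on {a<..<b})
    = (\<integral>s. g s * \<phi> s \<partial>lebesgue_on {a<..<b})"
proof -
  let ?M = "lebesgue_on {a<..<b}"
  let ?K = "\<lambda>s t. g s * max 0 (t - s) * deriv (deriv \<phi>) t"
  interpret M: finite_measure ?M by (rule finite_measure_lebesgue_on_Ioo)
  interpret MM: pair_sigma_finite ?M ?M ..
  interpret P: finite_measure "?M \<Otimes>\<^sub>M ?M"
    by (rule finite_measure_pair_measure[OF M.finite_measure_axioms M.finite_measure_axioms])
  note \<phi>'' = test_functions_imp_continuous_on[OF deriv_in_test_functions[OF deriv_in_test_functions[OF \<phi> ab] ab]]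
  have "bounded (deriv (deriv \<phi>) ` {a..b})"
    by (rule compact_imp_bounded[OF compact_continuous_image[OF \<phi>'' compact_Icc]])
  then obtain D where "\<forall>y\<in>deriv (deriv \<phi>) ` {a..b}. norm y \<le> D"
    unfolding bounded_iff ..
  then have D: "\<bar>deriv (deriv \<phi>) t\<bar> \<le> D" if "t \<in> {a<..<b}" for t
    using that by simp
  have [measurable]: "(\<lambda>s. s) \<in> borel_measurable ?M"
    by (rule borel_measurable_integrable[OF integrable_continuous[OF continuous_on_id]])
  have [measurable]: "deriv (deriv \<phi>) \<in> borel_measurable ?M"
    by (rule borel_measurable_integrable[OF integrable_continuous[OF \<phi>'']])
  note g[measurable]
  have "integrable (?M \<Otimes>\<^sub>M ?M) (case_prod ?K)"
  \<comment> \<open>The three factors bound \<open>g\<close>, the kernel on the square, and the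
    second derivative of \<open>\<phi>\<close>.\<close>
  proof (rule P.integrable_const_bound[where B="C * (b - a) * D"])
    show "case_prod ?K \<in> borel_measurable (?M \<Otimes>\<^sub>M ?M)"
      by measurable
    show "AE x in ?M \<Otimes>\<^sub>M ?M. norm (case_prod ?K x) \<le> C * (b - a) * D"
    proof (rule AE_I2)
      fix x assume "x \<in> space (?M \<Otimes>\<^sub>M ?M)"
      then obtain s t where x: "x = (s, t)" and st: "s \<in> {a<..<b}" "t \<in> {a<..<b}"
        by (auto simp: space_pair_measure)
      have "\<bar>g s\<bar> * \<bar>max 0 (t - s)\<bar> * \<bar>deriv (deriv \<phi>) t\<bar> \<le> C * (b - a) * D"
        using st bnd[of s] D[OF st(2)] by (intro mult_mono) auto
      then show "norm (case_prod ?K x) \<le> C * (b - a) * D"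
        by (simp add: x abs_mult)
    qed
  qed
  then have "(\<integral>t. (\<integral>s. ?K s t \<partial>?M) \<partial>?M) = (\<integral>s. (\<integral>t. ?K s t \<partial>?M) \<partial>?M)"
    by (rule MM.Fubini_integral)
  moreover have "(\<integral>s. ?K s t \<partial>?M) = (\<integral>s. g s * max 0 (t - s) \<partial>?M) * deriv (deriv \<phi>) t" for t
    by simp
  moreover have "(\<integral>s. (\<integral>t. ?K s t \<partial>?M) \<partial>?M) = (\<integral>s. g s * \<phi> s \<partial>?M)"
    using test_functions_kernel_representation[OF \<phi>]
    by (intro Bochner_Integration.integral_cong) (simp_all add: mult.assoc)
  ultimately show ?thesis by simp
qed

lemma weak_solution_representation:
  fixes u g :: "real \<Rightarrow> real"
  assumes ab: "a < b" and u: "integrable (lebesgue_on {a<..<b}) u"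
    and g: "g \<in> borel_measurable (lebesgue_on {a<..<b})" and bnd: "\<And>s. \<bar>g s\<bar> \<le> C"
    and weak: "\<And>\<phi>. \<phi> \<in> test_functions a b \<Longrightarrow>
      (\<integral>s. u s * deriv (deriv \<phi>) s + g s * \<phi> s \<partial>lebesgue_on {a<..<b}) = 0"
  obtains A B where "AE t in lebesgue_on {a<..<b}.
      u t = A + B * t - (\<integral>s. g s * max 0 (t - s) \<partial>lebesgue_on {a<..<b})"
proof -
  let ?M = "lebesgue_on {a<..<b}"
  let ?H = "\<lambda>t. \<integral>s. g s * max 0 (t - s) \<partial>?M"
  have gi: "integrable ?M g"
    by (rule borel_measurable_imp_bounded_integrable[OF g bnd])
  have H: "integrable ?M ?H"
    by (rule integrable_continuous[OF continuous_on_integral_kernel[OF gi]])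
  have "(\<integral>s. (u s + ?H s) * deriv (deriv \<phi>) s \<partial>?M) = 0" if \<phi>: "\<phi> \<in> test_functions a b" for \<phi>
  proof -
    note \<phi>'' = test_functions_imp_continuous_on[OF deriv_in_test_functions[OF deriv_in_test_functions[OF \<phi> ab] ab]]
    note i = integrable_mult_continuous[OF u \<phi>''] integrable_mult_continuous[OF H \<phi>'']
      integrable_mult_continuous[OF gi test_functions_imp_continuous_on[OF \<phi>]]
    have "(\<integral>s. (u s + ?H s) * deriv (deriv \<phi>) s \<partial>?M)
        = (\<integral>s. u s * deriv (deriv \<phi>) s \<partial>?M) + (\<integral>s. ?H s * deriv (deriv \<phi>) s \<partial>?M)"
      unfolding distrib_right by (rule Bochner_Integration.integral_add[OF i(1,2)])
    also have "\<dots> = (\<integral>s. u s * deriv (deriv \<phi>) s \<partial>?M) + (\<integral>s. g s * \<phi> s \<partial>?M)"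
      by (simp only: integral_test_function_by_parts[OF g bnd \<phi> ab])
    also have "\<dots> = (\<integral>s. u s * deriv (deriv \<phi>) s + g s * \<phi> s \<partial>?M)"
      by (rule Bochner_Integration.integral_add[OF i(1,3), symmetric])
    finally show ?thesis using weak[OF \<phi>] by simp
  qed
  then obtain A B where "AE s in ?M. u s + ?H s = A + B * s"
    using du_Bois_Reymond_second_order[OF ab Bochner_Integration.integrable_add[OF u H]] by blast
  then have "AE t in ?M. u t = A + B * t - ?H t"
    by (rule eventually_mono) simp
  then show thesis by (rule that)
qed

section \<open>Regularity of weak solutions for a continuous nonlinearity\<close>

lemma weak_solution_regularity:
  fixes f w :: "real \<Rightarrow> real"
  assumes ab: "a < b" and "p \<noteq> 0" and w: "w \<in> Linfty_on a b" and f: "continuous_on UNIV f"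
    and weak: "\<And>\<phi>. \<phi> \<in> test_functions a b \<Longrightarrow>
      (\<integral>s. p * w s * deriv (deriv \<phi>) s + f (w s) * \<phi> s \<partial>lebesgue_on {a<..<b}) = 0"
  shows "\<exists>v v' v''. (AE s in lebesgue_on {a<..<b}. w s = v s) \<and> C2_on_Icc_with a b v v' v'' \<and>
    (\<forall>s\<in>{a..b}. p * v'' s + f (v s) = 0)"
proof -
  let ?M = "lebesgue_on {a<..<b}"
  have wm: "w \<in> borel_measurable ?M"
    using w by (simp add: Linfty_on_def)
  obtain C where C: "AE s in ?M. \<bar>w s\<bar> \<le> C"
    using w by (auto simp: Linfty_on_def)
  \<comment> \<open>Truncation turns the almost-everywhere bound into a pointwise one, so that
    \<open>f (W s)\<close> is bounded everywhere by compactness. The absolute value makes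
    \<open>{- \<bar>C\<bar>..\<bar>C\<bar>}\<close> nonempty without first proving
    \<open>0 \<le> C\<close>.\<close>
  define W where "W s = max (- \<bar>C\<bar>) (min \<bar>C\<bar> (w s))" for s
  have W_bound: "\<bar>W s\<bar> \<le> \<bar>C\<bar>" for s
    by (simp add: W_def max_def min_def abs_if)
  have wW: "AE s in ?M. w s = W s"
    using C by (rule eventually_mono) (simp add: W_def max_def min_def abs_if split: if_splits)
  have Wm: "W \<in> borel_measurable ?M"
    unfolding W_def using wm by measurable
  have fm: "f \<in> borel_measurable borel"
    by (rule borel_measurable_continuous_onI[OF f])
  have gm: "(\<lambda>s. f (W s)) \<in> borel_measurable ?M"
    by (rule measurable_compose[OF Wm fm])
  have "bounded (f ` {- \<bar>C\<bar>..\<bar>C\<bar>})"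
    by (rule compact_imp_bounded[OF compact_continuous_image[OF continuous_on_subset[OF f subset_UNIV] compact_Icc]])
  then obtain D where D: "\<forall>y\<in>f ` {- \<bar>C\<bar>..\<bar>C\<bar>}. norm y \<le> D"
    unfolding bounded_iff ..
  have g_bound: "\<bar>f (W s)\<bar> \<le> D" for s
    using D W_bound[of s] by (simp add: abs_le_iff)
  have Wi: "integrable ?M (\<lambda>s. p * W s)"
    by (rule integrable_mult_right[OF borel_measurable_imp_bounded_integrable[OF Wm W_bound]])
  have gi: "integrable ?M (\<lambda>s. f (W s))"
    by (rule borel_measurable_imp_bounded_integrable[OF gm g_bound])
  have weakW: "(\<integral>s. p * W s * deriv (deriv \<phi>) s + f (W s) * \<phi> s \<partial>?M) = 0"
    if \<phi>: "\<phi> \<in> test_functions a b" for \<phi>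
  proof -
    have [measurable]: "\<phi> \<in> borel_measurable ?M" "deriv (deriv \<phi>) \<in> borel_measurable ?M"
      by (rule borel_measurable_integrable[OF integrable_continuous[OF test_functions_imp_continuous_on[OF \<phi>]]])
        (rule borel_measurable_integrable[OF integrable_continuous[OF test_functions_imp_continuous_on[OF
            deriv_in_test_functions[OF deriv_in_test_functions[OF \<phi> ab] ab]]]])
    note wm[measurable] Wm[measurable] fm[measurable]
    have "(\<integral>s. p * w s * deriv (deriv \<phi>) s + f (w s) * \<phi> s \<partial>?M)
        = (\<integral>s. p * W s * deriv (deriv \<phi>) s + f (W s) * \<phi> s \<partial>?M)"
    proof (rule integral_cong_AE)
      show "AE s in ?M. p * w s * deriv (deriv \<phi>) s + f (w s) * \<phi> s
          = p * W s * deriv (deriv \<phi>) s + f (W s) * \<phi> s"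
        using wW by (rule eventually_mono) simp
    qed measurable
    then show ?thesis using weak[OF \<phi>] by simp
  qed
  obtain A B where AB: "AE t in ?M. p * W t = A + B * t - (\<integral>s. f (W s) * max 0 (t - s) \<partial>?M)"
    using weak_solution_representation[OF ab Wi gm g_bound weakW] by blast
  \<comment> \<open>The continuous representative, defined on the whole line so that
    \<open>f (V t)\<close> has global antiderivatives.\<close>
  define V where "V t = (A + B * t - (\<integral>s. f (W s) * max 0 (t - s) \<partial>?M)) / p" for t
  have WV: "AE t in ?M. W t = V t"
    using AB by (rule eventually_mono) (use \<open>p \<noteq> 0\<close> in \<open>simp add: V_def field_simps\<close>)
  have V: "continuous_on UNIV V"
    unfolding V_def by (intro continuous_intros continuous_on_integral_kernel gi) (use \<open>p \<noteq> 0\<close> in simp)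
  define F where "F t = f (V t)" for t
  have F: "continuous_on UNIV F"
    unfolding F_def by (rule continuous_on_compose2[OF f V subset_UNIV])
  obtain F1 where F1: "\<And>x. (F1 has_real_derivative F x) (at x)"
    using continuous_imp_antiderivative[OF F] by blast
  obtain F2 where F2: "\<And>x. (F2 has_real_derivative F1 x) (at x)"
    using continuous_imp_antiderivative[OF DERIV_continuous_on[OF has_field_derivative_at_within[OF F1]]] by blast
  \<comment> \<open>The bootstrap: the integral does not distinguish \<open>W\<close> from
    \<open>V\<close>, and with the continuous integrand \<open>F\<close> the Taylor formula
    applies.\<close>
  have H: "(\<integral>s. f (W s) * max 0 (t - s) \<partial>?M) = F2 t - F2 a - (t - a) * F1 a" if "t \<in> {a..b}" for t
  proof -
    have "(\<integral>s. f (W s) * max 0 (t - s) \<partial>?M) = (\<integral>s. F s * max 0 (t - s) \<partial>?M)"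
    proof (rule integral_cong_AE)
      have c: "continuous_on UNIV (\<lambda>s. max 0 (t - s))"
        by (intro continuous_intros)
      show "(\<lambda>s. f (W s) * max 0 (t - s)) \<in> borel_measurable ?M"
        by (rule borel_measurable_integrable[OF integrable_mult_continuous[OF gi c]])
      show "(\<lambda>s. F s * max 0 (t - s)) \<in> borel_measurable ?M"
        by (rule borel_measurable_integrable[OF integrable_mult_continuous[OF integrable_continuous[OF F] c]])
      show "AE s in ?M. f (W s) * max 0 (t - s) = F s * max 0 (t - s)"
        using WV by (rule eventually_mono) (simp add: F_def)
    qed
    then show ?thesis
      using integral_kernel_eq[OF F1 F2 F that] by simp
  qed
  \<comment> \<open>\<open>v\<close> agrees with \<open>V\<close> only on \<open>{a..b}\<close>, but
    its closed form in \<open>F1\<close> and \<open>F2\<close> can be differentiated directly, also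
    at the endpoints.\<close>
  define v where "v t = (A + B * t - (F2 t - F2 a - (t - a) * F1 a)) / p" for t
  have vV: "v t = V t" if "t \<in> {a..b}" for t
    using H[OF that] by (simp add: v_def V_def)
  have "AE t in ?M. w t = v t"
  proof -
    have "AE t in ?M. t \<in> {a<..<b}"
      by (rule AE_I2) simp
    with wW WV show ?thesis
      by eventually_elim (simp add: vV)
  qed
  moreover have "C2_on_Icc_with a b v (\<lambda>t. (B - (F1 t - F1 a)) / p) (\<lambda>t. - F t / p)"
    unfolding C2_on_Icc_with_def
  proof (intro conjI ballI)
    fix s
    have "((\<lambda>t. A + B * t - (F2 t - F2 a - (t - a) * F1 a)) has_real_derivative B - (F1 s - F1 a)) (at s within {a..b})"
      by (auto intro!: derivative_eq_intros has_field_derivative_at_within[OF F2])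
    from DERIV_cdivide[OF this, of p]
    show "(v has_real_derivative (B - (F1 s - F1 a)) / p) (at s within {a..b})"
      by (simp add: v_def[abs_def])
    have "((\<lambda>t. B - (F1 t - F1 a)) has_real_derivative - F s) (at s within {a..b})"
      by (auto intro!: derivative_eq_intros has_field_derivative_at_within[OF F1])
    from DERIV_cdivide[OF this, of p]
    show "((\<lambda>t. (B - (F1 t - F1 a)) / p) has_real_derivative - F s / p) (at s within {a..b})" .
    show "continuous_on {a..b} (\<lambda>t. - F t / p)"
      by (intro continuous_intros continuous_on_subset[OF F subset_UNIV]) (use \<open>p \<noteq> 0\<close> in simp)
  qed
  moreover have "\<forall>s\<in>{a..b}. p * (- F s / p) + f (v s) = 0"
    using \<open>p \<noteq> 0\<close> by (simp add: F_def vV)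
  ultimately show ?thesis by blast
qed

text \<open>At 0 the absolute value of the product is \<open>\<bar>x\<bar> powr (c + 1)\<close>,
  whose exponent is positive even if \<open>c\<close> is negative; elsewhere both factors are
  continuous.\<close>

lemma continuous_on_abs_powr_mult:
  fixes c :: real
  assumes "- 1 < c"
  shows "continuous_on S (\<lambda>x::real. \<bar>x\<bar> powr c * x)"
proof (rule continuous_at_imp_continuous_on, rule ballI)
  fix x :: real
  show "isCont (\<lambda>x. \<bar>x\<bar> powr c * x) x"
  proof (cases "x = 0")
    case True
    have "((\<lambda>x::real. \<bar>x\<bar> powr (c + 1)) \<longlongrightarrow> \<bar>0\<bar> powr (c + 1)) (at 0)"
      using assms by (intro tendsto_powr' tendsto_rabs tendsto_ident_at) auto
    \<comment> \<open>This holds at \<open>x = 0\<close> too, because \<open>0 powr c = 0\<close>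
      for every \<open>c\<close>; that default matches reading the singular expression as 0
      there.\<close>
    moreover have "(\<lambda>x::real. \<bar>x\<bar> powr (c + 1)) = (\<lambda>x. \<bar>\<bar>x\<bar> powr c * x\<bar>)"
      by (rule ext) (simp add: powr_add abs_mult)
    ultimately have "((\<lambda>x::real. \<bar>\<bar>x\<bar> powr c * x\<bar>) \<longlongrightarrow> 0) (at 0)"
      by simp
    then have "((\<lambda>x::real. \<bar>x\<bar> powr c * x) \<longlongrightarrow> 0) (at 0)"
      by (rule tendsto_rabs_zero_cancel)
    then show ?thesis using True by (simp add: isCont_def)
  next
    case False
    then have "isCont (\<lambda>x. \<bar>x\<bar> powr c) x"
      unfolding isCont_def by (intro tendsto_powr tendsto_rabs tendsto_ident_at tendsto_const) simp
    then show ?thesis by (rule isCont_mult[OF _ continuous_ident])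
  qed
qed

theorem lemma4p3:
  fixes p L lam :: real and w :: "real \<Rightarrow> real"
  assumes "1 < p" and "0 < L"
    and "w \<in> Linfty_on 0 L"
    and "\<And>\<phi>. \<phi> \<in> test_functions 0 L \<Longrightarrow>
      integral\<^sup>L (lebesgue_on {0<..<L})
        (\<lambda>s. p * w s * deriv (deriv \<phi>) s
           + (p - 1) * \<bar>w s\<bar> powr (2 / (p - 1)) * w s * \<phi> s
           - lam * \<bar>w s\<bar> powr ((2 - p) / (p - 1)) * w s * \<phi> s) = 0"
  shows "\<exists>v v' v''.
      (AE s in lebesgue_on {0<..<L}. w s = v s) \<and>
      C2_on_Icc_with 0 L v v' v'' \<and>
      (\<forall>s\<in>{0..L}. p * v'' s
           + (p - 1) * \<bar>v s\<bar> powr (2 / (p - 1)) * v s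
           - lam * \<bar>v s\<bar> powr ((2 - p) / (p - 1)) * v s = 0)"
proof -
  define f where "f x = (p - 1) * (\<bar>x\<bar> powr (2 / (p - 1)) * x) - lam * (\<bar>x\<bar> powr ((2 - p) / (p - 1)) * x)"
    for x :: real
  \<comment> \<open>Adding 1 to the exponents gives \<open>(p + 1) / (p - 1)\<close> and
    \<open>1 / (p - 1)\<close>, both positive for \<open>1 < p\<close>.\<close>
  have exps: "- 1 < 2 / (p - 1)" "- 1 < (2 - p) / (p - 1)"
    using \<open>1 < p\<close> by (simp_all add: field_simps)
  have "continuous_on UNIV f"
    unfolding f_def by (intro continuous_intros continuous_on_abs_powr_mult exps)
  moreover have "(\<integral>s. p * w s * deriv (deriv \<phi>) s + f (w s) * \<phi> s \<partial>lebesgue_on {0<..<L}) = 0"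
    if "\<phi> \<in> test_functions 0 L" for \<phi>
    using assms(4)[OF that] by (simp add: f_def algebra_simps)
  ultimately obtain v v' v'' where "AE s in lebesgue_on {0<..<L}. w s = v s"
    "C2_on_Icc_with 0 L v v' v''" "\<forall>s\<in>{0..L}. p * v'' s + f (v s) = 0"
    using weak_solution_regularity[OF \<open>0 < L\<close> _ assms(3), of p f] \<open>1 < p\<close> by auto
  then show ?thesis
    by (intro exI[of _ v] exI[of _ v'] exI[of _ v'']) (simp add: f_def algebra_simps)
qed

end
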